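(* For every integer $r\geq 0$, $$\zeta(\underbrace{2,2,\ldots,2}_{r},3)=-4(2r+3)\left(\sum_{n=0}^{\infty}\frac{\zeta(2n)}{(2n+2r+2)(2n+2r+3)\,2^{2n}}\right)\zeta(\underbrace{2,2,\ldots,2}_{r+1}).$$
   Context: For positive integers $k_1,\ldots,k_m$ with $k_m>1$, the multiple zeta value is $\zeta(k_1,\ldots,k_m)=\sum_{0<n_1<n_2<\cdots<n_m}\frac{1}{n_1^{k_1}n_2^{k_2}\cdots n_m^{k_m}}$. Thus $\zeta(\underbrace{2,\ldots,2}_{r},3)=\sum_{0<n_1<\cdots<n_{r+1}}\frac{1}{n_1^2\cdots n_r^2\,n_{r+1}^3}$ (equal to $\zeta(3)$ when $r=0$). In the series, $\zeta(2n)$ denotes the Riemann zeta value, with $\zeta(0)=-\tfrac12$ (value of the analytic continuation) for the $n=0$ term. *)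

theory Defs
  imports "HOL-Analysis.Analysis"
begin

text \<open>Multiple zeta value zeta(k_1,...,k_m) = sum over 0 < n_1 < ... < n_m of
  prod_i 1 / n_i^(k_i). The index tuples are strictly increasing lists of positive
  naturals of the same length as the exponent list. All terms are nonnegative, so the
  unordered sum (infsum) is the sum of the series.\<close>
definition mzv :: "nat list \<Rightarrow> real" where
  "mzv ks = (\<Sum>\<^sub>\<infinity> ns \<in> {ns. length ns = length ks \<and> sorted_wrt (<) ns \<and> (\<forall>n\<in>set ns. 0 < n)}.
              \<Prod>i<length ks. 1 / real (ns ! i) ^ (ks ! i))"

text \<open>Riemann zeta at even nonnegative integers: zeta_even n = zeta(2n),
  with zeta(0) = -1/2 (analytic continuation) and zeta(2n) = sum_{k>=1} k^(-2n) for n >= 1.\<close>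
definition zeta_even :: "nat \<Rightarrow> real" where
  "zeta_even n = (if n = 0 then - 1 / 2 else (\<Sum>k. 1 / real (Suc k) ^ (2 * n)))"

end

theory Submission
  imports Defs
begin

text \<open>
  Write H(r, n) for the sum of 1/(n_1^2 ... n_r^2) over 0 < n_1 < ... < n_r < n, so that
  zeta(2,...,2,k) is the sum of H(r, n)/n^k. On (-pi/2, pi/2),
    (2t)^(2r+2)/(2r+2)! = sum over n >= 1 of 4^n H(r, n) sin(t)^(2n) / (n^2 binom(2n, n)),
  because, as functions of t, both sides vanish to second order at 0 and have second derivative
  4 times the identity for r - 1 (which reads 1 = 1 when r = 0). By Wallis' formula, integrating
  over (0, pi/2) turns the right-hand side into (pi/2) zeta(2,...,2), and integrating against
  (pi/2 - t) cot t, which contributes another 1/(2n), turns it into (pi/4) zeta(2,...,2,3). The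
  second integral is also evaluated with t cot t = -2 (sum of zeta(2n) (t/pi)^(2n)), which comes
  from the logarithmic derivative of the sine product.
\<close>

subsection \<open>Wallis integrals\<close>

text \<open>This is binom(2n, n) / 4^n.\<close>
definition wallis_ratio :: "nat \<Rightarrow> real" where
  "wallis_ratio n = pochhammer (1/2) n / fact n"

lemma wallis_ratio_0 [simp]: "wallis_ratio 0 = 1"
  by (simp add: wallis_ratio_def)

lemma wallis_ratio_Suc:
  "wallis_ratio (Suc n) = wallis_ratio n * (2 * real n + 1) / (2 * real n + 2)"
  by (simp add: wallis_ratio_def pochhammer_Suc field_simps)

lemma wallis_ratio_pos: "wallis_ratio n > 0"
  by (simp add: wallis_ratio_def pochhammer_pos)

text \<open>The quantity starts at 1/2 for \<open>n = 1\<close> and never decreases. This crude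
  bound keeps the coefficients \<open>arcsin_coeff\<close> bounded.\<close>

lemma wallis_ratio_lower: "n > 0 \<Longrightarrow> 1 / 2 \<le> real n ^ 2 * wallis_ratio n"
proof (induction n rule: nat_induct_non_zero)
  case 1
  show ?case by (simp add: wallis_ratio_Suc[of 0, simplified])
next
  case (Suc n)
  have "real n ^ 2 \<le> real (Suc n) * (2 * real n + 1) / 2"
    by (simp add: power2_eq_square field_simps)
  then have "real n ^ 2 * wallis_ratio n \<le> real (Suc n) * (2 * real n + 1) / 2 * wallis_ratio n"
    using wallis_ratio_pos[of n] by (intro mult_right_mono) auto
  also have "\<dots> = real (Suc n) ^ 2 * wallis_ratio (Suc n)"
    by (simp add: wallis_ratio_Suc power2_eq_square field_simps)
  finally show ?case using Suc by simp
qed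

text \<open>Wallis' recursion: the derivative of \<open>- cos x * sin x ^ (2 * n + 1)\<close>
  relates two consecutive even powers, and this function vanishes at 0 and at pi/2.\<close>

lemma has_integral_sin_power_even:
  "((\<lambda>x. sin x ^ (2 * n)) has_integral pi / 2 * wallis_ratio n) {0..pi/2}"
proof (induction n)
  case 0
  show ?case using has_integral_const_real[of "1::real" 0 "pi/2"] by simp
next
  case (Suc n)
  have "((\<lambda>x. real (2 * n + 2) * sin x ^ (2 * n + 2) - real (2 * n + 1) * sin x ^ (2 * n))
      has_integral (- cos (pi/2) * sin (pi/2) ^ (2 * n + 1)) - (- cos 0 * sin 0 ^ (2 * n + 1))) {0..pi/2}"
  proof (rule fundamental_theorem_of_calculus)
    fix x :: real
    have cs: "(cos x)\<^sup>2 = 1 - sin x * sin x"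
      by (simp only: cos_squared_eq power2_eq_square[of "sin x"])
    have eq: "real (2 * n + 2) * sin x ^ (2 * n + 2) - real (2 * n + 1) * sin x ^ (2 * n) =
       sin x * sin x ^ (2*n+1) - real (2 * n + 1) * sin x ^ (2 * n) * (cos x)\<^sup>2"
      unfolding cs by (simp add: algebra_simps)
    have "((\<lambda>x. - cos x * sin x ^ (2 * n + 1)) has_field_derivative
        sin x * sin x ^ (2*n+1) - real (2 * n + 1) * sin x ^ (2 * n) * (cos x)\<^sup>2)
        (at x within {0..pi/2})"
      by (rule derivative_eq_intros refl | simp add: power2_eq_square algebra_simps)+
    then show "((\<lambda>x. - cos x * sin x ^ (2 * n + 1)) has_vector_derivative
       real (2 * n + 2) * sin x ^ (2 * n + 2) - real (2 * n + 1) * sin x ^ (2 * n))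
        (at x within {0..pi/2})"
      unfolding eq has_real_derivative_iff_has_vector_derivative .
  qed simp
  from has_integral_add[OF this has_integral_mult_right[OF Suc, of "real (2*n+1)"]]
  have "((\<lambda>x. real (2 * n + 2) * sin x ^ (2 * n + 2)) has_integral
      real (2 * n + 1) * (pi / 2 * wallis_ratio n)) {0..pi/2}"
    by simp
  from has_integral_divide[OF this, of "real (2*n+2)"]
  show ?case
    by (simp add: wallis_ratio_Suc field_simps del: of_nat_add of_nat_Suc) (simp add: field_simps)
qed

text \<open>Integration by parts against \<open>?F\<close>, which vanishes at both ends, leaves the
  Wallis integral divided by \<open>2 * n\<close>. This extra factor later raises the last exponent
  from 2 to 3.\<close>

lemma has_integral_weight_sin_power:
  assumes "n > 0"
  shows "((\<lambda>x. (pi/2 - x) * cot x * sin x ^ (2 * n)) has_integral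
           pi / (4 * real n) * wallis_ratio n) {0..pi/2}"
proof -
  let ?F = "\<lambda>x. (pi/2 - x) * sin x ^ (2 * n) / real (2 * n)"
  \<comment> \<open>The exponent is at least 2, so a power of \<open>sin x\<close> survives the
    cancellation with \<open>cot x\<close> and both sides vanish where
    \<open>sin x = 0\<close>.\<close>
  obtain k where k: "2 * n = Suc (Suc k)" using assms by (metis Suc_pred' mult_2 add_gr_0 add_Suc_right)
  have "((\<lambda>x. (pi/2 - x) * cot x * sin x ^ (2 * n) - sin x ^ (2 * n) / real (2 * n))
      has_integral ?F (pi/2) - ?F 0) {0..pi/2}"
  proof (rule fundamental_theorem_of_calculus)
    fix x :: real
    have "(?F has_field_derivative
        (pi/2 - x) * (cos x * sin x ^ (2 * n - 1)) - sin x ^ (2 * n) / real (2 * n))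
        (at x within {0..pi/2})"
      using assms by (auto intro!: derivative_eq_intros simp: field_simps)
    moreover have "cot x * sin x ^ (2 * n) = cos x * sin x ^ (2 * n - 1)"
      unfolding k by (cases "sin x = 0") (auto simp: cot_def)
    ultimately show "(?F has_vector_derivative
       (pi/2 - x) * cot x * sin x ^ (2 * n) - sin x ^ (2 * n) / real (2 * n))
        (at x within {0..pi/2})"
      by (simp add: has_real_derivative_iff_has_vector_derivative mult.assoc)
  qed simp
  from has_integral_add[OF this has_integral_divide[OF has_integral_sin_power_even[of n], of "real (2*n)"]]
  show ?thesis using assms by (simp add: zero_power)
qed

section \<open>Termwise integration of series\<close>

text \<open>The term of index 0 is exempt from the sign condition because zeta(0) = -1/2 is negative.\<close>
lemma has_integral_nonneg_series:
  fixes g :: "nat \<Rightarrow> 'a::euclidean_space \<Rightarrow> real"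
  assumes "\<And>n. (g n has_integral I n) S"
    and nn: "\<And>n x. 0 < n \<Longrightarrow> x \<in> S \<Longrightarrow> 0 \<le> g n x"
    and "\<And>x. x \<in> S \<Longrightarrow> (\<lambda>n. g n x) sums f x"
    and "summable I"
  shows "(f has_integral suminf I) S"
proof (rule has_integral_monotone_convergence_increasing)
  \<comment> \<open>Partial sums run up to \<open>Suc k\<close> so that all of them contain the term
    of index 0, whatever its sign; they then increase with \<open>k\<close>.\<close>
  show "((\<lambda>x. \<Sum>n<Suc k. g n x) has_integral (\<Sum>n<Suc k. I n)) S" for k
    by (intro has_integral_sum assms) auto
  show "(\<Sum>n<Suc k. g n x) \<le> (\<Sum>n<Suc (Suc k). g n x)" if "x \<in> S" for k x
    using nn[OF _ that, of "Suc k"] by simp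
  show "(\<lambda>k. \<Sum>n<Suc k. g n x) \<longlonglongrightarrow> f x" if "x \<in> S" for x
    using assms(3)[OF that] unfolding sums_def by (rule LIMSEQ_Suc)
  show "(\<lambda>k. \<Sum>n<Suc k. I n) \<longlonglongrightarrow> suminf I"
    using summable_LIMSEQ[OF assms(4)] by (rule LIMSEQ_Suc)
qed

subsection \<open>Power series of even powers of the arcsine\<close>

text \<open>The terms j = 0 below, and n = 0 in arcsin_coeff, vanish because of x / 0 = 0.\<close>
fun nested_sum :: "nat \<Rightarrow> nat \<Rightarrow> real" where
  "nested_sum 0 n = 1"
| "nested_sum (Suc r) n = (\<Sum>j<n. nested_sum r j / real j ^ 2)"

lemma nested_sum_nonneg: "nested_sum r n \<ge> 0"
  by (induction r arbitrary: n) (auto intro!: sum_nonneg)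

text \<open>A bound for \<open>r\<close> yields one for \<open>Suc r\<close> because the sum of
  \<open>1 / j ^ 2\<close> converges.\<close>

lemma nested_sum_bounded: "\<exists>B. \<forall>n. nested_sum r n \<le> B"
proof (induction r)
  case (Suc r)
  then obtain B where B: "\<And>n. nested_sum r n \<le> B" by auto
  have s: "summable (\<lambda>j. B * (1 / real j ^ 2))"
    using inverse_power_summable[of 2, where ?'a = real]
    by (intro summable_mult) (simp add: inverse_eq_divide)
  have "nested_sum (Suc r) n \<le> (\<Sum>j. B * (1 / real j ^ 2))" for n
  proof -
    have "nested_sum (Suc r) n \<le> (\<Sum>j<n. B * (1 / real j ^ 2))"
      using B by (auto intro!: sum_mono divide_right_mono)
    also have "\<dots> \<le> (\<Sum>j. B * (1 / real j ^ 2))"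
      using order_trans[OF nested_sum_nonneg B] by (intro sum_le_suminf s) auto
    finally show ?thesis .
  qed
  then show ?case by blast
qed auto

lemma summable_nested_sum_over_power:
  assumes "k \<ge> 2"
  shows "summable (\<lambda>n. nested_sum r n / real n ^ k)"
proof -
  obtain B where B: "\<And>n. nested_sum r n \<le> B" using nested_sum_bounded by blast
  have s: "summable (\<lambda>n. B * inverse (real n ^ k))"
    using inverse_power_summable[OF assms, where ?'a = real] by (intro summable_mult) simp
  show ?thesis
    using B nested_sum_nonneg
    by (intro summable_comparison_test'[OF s, of 0])
       (auto simp: divide_inverse intro!: mult_right_mono)
qed

text \<open>For \<open>m = 1\<close> these are the coefficients 4^n / (n^2 binom(2n, n)) of the
  classical series of 2 arcsin(y)^2 in powers of y^2.\<close>

fun arcsin_coeff :: "nat \<Rightarrow> nat \<Rightarrow> real" where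
  "arcsin_coeff 0 n = (if n = 0 then 1 else 0)"
| "arcsin_coeff (Suc m) n = nested_sum m n / (real n ^ 2 * wallis_ratio n)"

lemma arcsin_coeff_nonneg: "arcsin_coeff m n \<ge> 0"
  using wallis_ratio_pos[of n] by (cases m) (auto simp: nested_sum_nonneg)

text \<open>This is the differential equation of the generating series, read off at one power. The
  recurrence of \<open>wallis_ratio\<close> absorbs the two linear factors on the left.\<close>

lemma arcsin_coeff_rec:
  "(2 * real n + 2) * (2 * real n + 1) * arcsin_coeff (Suc m) (Suc n) =
     4 * real n ^ 2 * arcsin_coeff (Suc m) n + 4 * arcsin_coeff m n"
proof (cases "n = 0")
  case True
  then show ?thesis
    by (cases m) (auto simp: wallis_ratio_Suc)
next
  case False
  define q where "q = wallis_ratio n"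
  have q: "q > 0" by (simp add: q_def wallis_ratio_pos)
  have "(2 * real n + 2) * (2 * real n + 1) * arcsin_coeff (Suc m) (Suc n) =
      (2 * real n + 2) * (2 * real n + 1) * nested_sum m (Suc n) /
      ((real n + 1) ^ 2 * (q * (2 * real n + 1) / (2 * real n + 2)))"
    by (simp add: wallis_ratio_Suc q_def add.commute)
  also have "\<dots> = 4 * nested_sum m (Suc n) / q"
  proof -
    have "(2 * real n + 2) * (2 * real n + 1) =
        4 / q * ((real n + 1) ^ 2 * (q * (2 * real n + 1) / (2 * real n + 2)))"
    proof -
      have "2 * N * z = 4 / q * (N ^ 2 * (q * z / (2 * N)))" if "N > 0" for N z :: real
        using q that by (simp add: field_simps power2_eq_square)
      from this[of "real n + 1" "2 * real n + 1"] show ?thesis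
        by (simp add: distrib_left)
    qed
    moreover have "(real n + 1) ^ 2 * (q * (2 * real n + 1) / (2 * real n + 2)) > 0"
      using q by (intro mult_pos_pos divide_pos_pos) auto
    ultimately show ?thesis by simp
  qed
  \<comment> \<open>For positive \<open>m\<close>, the last summand \<open>j = n\<close> of
    \<open>nested_sum m (Suc n)\<close> produces \<open>arcsin_coeff m n\<close>; for
    \<open>m = 0\<close> there is no such summand and that coefficient is 0.\<close>
  also have "\<dots> = 4 * real n ^ 2 * arcsin_coeff (Suc m) n + 4 * arcsin_coeff m n"
    using False q by (cases m) (auto simp: q_def[symmetric] field_simps)
  finally show ?thesis .
qed

text \<open>For positive \<open>m\<close>, \<open>nested_sum_bounded\<close> and
  \<open>wallis_ratio_lower\<close> bound the coefficients, so a geometric series dominates.\<close>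

lemma summable_arcsin_coeff:
  fixes x :: real
  assumes "\<bar>x\<bar> < 1"
  shows "summable (\<lambda>n. arcsin_coeff m n * x ^ n)"
proof (cases m)
  case 0
  then show ?thesis by (intro summable_finite[of "{0}"]) auto
next
  case (Suc k)
  obtain B where B: "\<And>n. nested_sum k n \<le> B" using nested_sum_bounded by blast
  have B0: "B \<ge> 0" using order_trans[OF nested_sum_nonneg B] .
  have s: "summable (\<lambda>n. 2 * B * \<bar>x\<bar> ^ n)"
    using assms by (intro summable_mult summable_geometric) auto
  have "arcsin_coeff m n \<le> 2 * B" for n
  proof (cases "n = 0")
    case False
    have "arcsin_coeff m n \<le> B / (1 / 2)"
      unfolding Suc arcsin_coeff.simps
      using False B B0 nested_sum_nonneg wallis_ratio_lower[of n]
      by (intro frac_le) auto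
    then show ?thesis by simp
  qed (use Suc B0 in auto)
  then show ?thesis
    by (intro summable_comparison_test'[OF s, of 0])
       (auto simp: abs_mult power_abs arcsin_coeff_nonneg intro!: mult_right_mono)
qed

section \<open>The generating series and its differential equation\<close>

definition arcsin_series :: "nat \<Rightarrow> real \<Rightarrow> real" where
  "arcsin_series m u = (\<Sum>n. arcsin_coeff m n * u ^ n)"

text \<open>The Euler operator x d/dx on a power series, needed for the differential equation and
  again for the cotangent series.\<close>

lemma sums_index_mult:
  fixes x :: real
  assumes "summable (\<lambda>n. diffs c n * x ^ n)"
  shows "(\<lambda>n. real n * c n * x ^ n) sums (x * (\<Sum>n. diffs c n * x ^ n))"
proof -
  have "(\<lambda>n. real n * c n * x ^ (n - Suc 0) * x) = (\<lambda>n. real n * c n * x ^ n)"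
    by (intro ext, rename_tac n, case_tac n) auto
  then show ?thesis
    using sums_mult2[OF diffs_equiv[OF assms], of x] by (simp add: mult.commute[of x])
qed

lemma summable_diffs_arcsin_coeff:
  fixes u :: real
  assumes "\<bar>u\<bar> < 1"
  shows "summable (\<lambda>n. diffs (arcsin_coeff m) n * u ^ n)"
  using assms summable_arcsin_coeff by (intro termdiff_converges[of u 1]) auto

lemma arcsin_series_deriv:
  assumes "\<bar>u\<bar> < 1"
  shows "(arcsin_series m has_real_derivative (\<Sum>n. diffs (arcsin_coeff m) n * u ^ n)) (at u)"
  unfolding arcsin_series_def using assms summable_arcsin_coeff
  by (intro termdiffs_strong'[of 1]) auto

lemma arcsin_series_deriv2:
  assumes "\<bar>u\<bar> < 1"
  shows "((\<lambda>u. \<Sum>n. diffs (arcsin_coeff m) n * u ^ n) has_real_derivative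
            (\<Sum>n. diffs (diffs (arcsin_coeff m)) n * u ^ n)) (at u)"
  using assms summable_diffs_arcsin_coeff by (intro termdiffs_strong'[of 1]) auto

text \<open>With u = sin(t)^2, the left-hand side is the second derivative of arcsin_series (Suc m) in t.\<close>
lemma arcsin_series_ode:
  fixes u :: real
  assumes u: "\<bar>u\<bar> < 1"
  shows "2 * (1 - 2 * u) * (\<Sum>n. diffs (arcsin_coeff (Suc m)) n * u ^ n)
    + 4 * u * (1 - u) * (\<Sum>n. diffs (diffs (arcsin_coeff (Suc m))) n * u ^ n)
    = 4 * arcsin_series m u" (is "2 * _ * ?D1 + _ * ?D2 = _")
proof -
  let ?a = "arcsin_coeff (Suc m)"
  have s1: "summable (\<lambda>n. diffs ?a n * u ^ n)"
    using u by (rule summable_diffs_arcsin_coeff)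
  have s2: "summable (\<lambda>n. diffs (diffs ?a) n * u ^ n)"
    using u summable_diffs_arcsin_coeff by (intro termdiff_converges[of u 1]) auto
  have S3: "(\<lambda>n. real n * diffs ?a n * u ^ n) sums (u * ?D2)"
    by (rule sums_index_mult[OF s2])
  \<comment> \<open>This is \<open>S3\<close> times \<open>u\<close>, shifted by one index; the new
    term at index 0 vanishes.\<close>
  have S4: "(\<lambda>n. real n * (real n - 1) * ?a n * u ^ n) sums (u * ?D2 * u)"
  proof (rule sums_Suc_imp)
    show "(\<lambda>n. real (Suc n) * (real (Suc n) - 1) * ?a (Suc n) * u ^ Suc n) sums (u * ?D2 * u)"
      using sums_mult2[OF S3, of u]
      by (simp add: diffs_def algebra_simps del: arcsin_coeff.simps)
  qed simp
  \<comment> \<open>The left-hand side splits into four series aligned on \<open>u ^ n\<close>, so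
    \<open>arcsin_coeff_rec\<close> applies coefficient by coefficient.\<close>
  have "(\<lambda>n. 2 * (diffs ?a n * u ^ n) - 4 * (real n * ?a n * u ^ n)
     + 4 * (real n * diffs ?a n * u ^ n) - 4 * (real n * (real n - 1) * ?a n * u ^ n))
     sums (2 * ?D1 - 4 * (u * ?D1) + 4 * (u * ?D2) - 4 * (u * ?D2 * u))"
    by (intro sums_add sums_diff sums_mult S3 S4 summable_sums[OF s1] sums_index_mult[OF s1])
  also have "(\<lambda>n. 2 * (diffs ?a n * u ^ n) - 4 * (real n * ?a n * u ^ n)
     + 4 * (real n * diffs ?a n * u ^ n) - 4 * (real n * (real n - 1) * ?a n * u ^ n))
     = (\<lambda>n. 4 * (arcsin_coeff m n * u ^ n))"
  proof
    fix n
    have "2 * (diffs ?a n * u ^ n) - 4 * (real n * ?a n * u ^ n)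
     + 4 * (real n * diffs ?a n * u ^ n) - 4 * (real n * (real n - 1) * ?a n * u ^ n)
     = ((2 * real n + 2) * (2 * real n + 1) * ?a (Suc n) - 4 * real n ^ 2 * ?a n) * u ^ n"
      by (simp add: diffs_def algebra_simps power2_eq_square del: arcsin_coeff.simps)
    also have "\<dots> = 4 * (arcsin_coeff m n * u ^ n)"
      unfolding arcsin_coeff_rec by simp
    finally show "2 * (diffs ?a n * u ^ n) - 4 * (real n * ?a n * u ^ n)
     + 4 * (real n * diffs ?a n * u ^ n) - 4 * (real n * (real n - 1) * ?a n * u ^ n)
     = 4 * (arcsin_coeff m n * u ^ n)" .
  qed
  finally have "(\<lambda>n. 4 * (arcsin_coeff m n * u ^ n)) sums
      (2 * ?D1 - 4 * (u * ?D1) + 4 * (u * ?D2) - 4 * (u * ?D2 * u))" .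
  moreover have "(\<lambda>n. 4 * (arcsin_coeff m n * u ^ n)) sums (4 * arcsin_series m u)"
    unfolding arcsin_series_def using u
    by (intro sums_mult summable_sums summable_arcsin_coeff)
  ultimately show ?thesis
    using sums_unique2 by (fastforce simp: algebra_simps)
qed

lemma sin_squared_less_1:
  fixes t :: real
  assumes "\<bar>t\<bar> < pi / 2"
  shows "\<bar>(sin t)\<^sup>2\<bar> < 1"
proof -
  have "cos t > 0" using assms by (intro cos_gt_zero_pi) auto
  then have "(cos t)\<^sup>2 > 0" by simp
  then have "(sin t)\<^sup>2 < 1" using sin_cos_squared_add[of t] by linarith
  then show ?thesis by (subst abs_of_nonneg) auto
qed

lemma scaled_power_deriv:
  fixes x :: real
  shows "((\<lambda>t. (2 * t) ^ Suc k / fact (Suc k)) has_real_derivative 2 * ((2 * x) ^ k / fact k))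
           (at x within S)"
proof -
  have "((\<lambda>t. (2 * t) ^ Suc k) has_real_derivative real (Suc k) * (2 * (2 * x) ^ k)) (at x within S)"
    by (rule derivative_eq_intros refl | simp)+
  from DERIV_cdivide[OF this, of "fact (Suc k)"] show ?thesis
    by (simp add: fact_Suc del: of_nat_Suc)
qed

text \<open>By induction the difference \<open>h\<close> of the two sides has second derivative 0,
  while \<open>h\<close> and its derivative \<open>h'\<close> vanish at 0. The range of
  \<open>t\<close> keeps the argument inside the disc of convergence.\<close>

lemma arcsin_series_sin:
  assumes "\<bar>t\<bar> < pi / 2"
  shows "arcsin_series m ((sin t)\<^sup>2) = (2 * t) ^ (2 * m) / fact (2 * m)"
  using assms
proof (induction m arbitrary: t)
  case 0
  have "(\<lambda>n. arcsin_coeff 0 n * ((sin t)\<^sup>2) ^ n) = (\<lambda>n. if n = 0 then ((sin t)\<^sup>2) ^ n else 0)"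
    by auto
  then have "(\<lambda>n. arcsin_coeff 0 n * ((sin t)\<^sup>2) ^ n) sums 1"
    using sums_single[of 0 "\<lambda>n. ((sin t)\<^sup>2) ^ n"] by simp
  then show ?case by (simp add: arcsin_series_def sums_iff)
next
  case (Suc m)
  let ?S = "{-(pi/2)<..<pi/2}"
  define p where "p = arcsin_series (Suc m)"
  define p' where "p' = (\<lambda>u. \<Sum>n. diffs (arcsin_coeff (Suc m)) n * u ^ n)"
  define p'' where "p'' = (\<lambda>u. \<Sum>n. diffs (diffs (arcsin_coeff (Suc m))) n * u ^ n)"
  define h where "h = (\<lambda>t. p ((sin t)\<^sup>2) - (2 * t) ^ (2 * Suc m) / fact (2 * Suc m))"
  define h' where "h' = (\<lambda>t. 2 * sin t * cos t * p' ((sin t)\<^sup>2)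
    - 2 * (2 * t) ^ (2 * m + 1) / fact (2 * m + 1))"
  have dp: "(p has_real_derivative p' u) (at u)"
       "(p' has_real_derivative p'' u) (at u)" if "\<bar>u\<bar> < 1" for u
    using arcsin_series_deriv[OF that] arcsin_series_deriv2[OF that]
    by (auto simp: p_def p'_def p''_def)
  have dh: "(h has_real_derivative h' x) (at x within ?S)" if "x \<in> ?S" for x
  proof -
    have u: "\<bar>(sin x)\<^sup>2\<bar> < 1" using that by (intro sin_squared_less_1) auto
    have "((\<lambda>t. p ((sin t)\<^sup>2)) has_real_derivative
        p' ((sin x)\<^sup>2) * (2 * sin x * cos x)) (at x within ?S)"
      by (rule DERIV_chain2[where f = p and g = "\<lambda>t. (sin t)\<^sup>2", OF dp(1)[OF u]])
         (auto intro!: derivative_eq_intros)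
    moreover have "((\<lambda>t. (2 * t) ^ (2 * Suc m) / fact (2 * Suc m)) has_real_derivative
        2 * (2 * x) ^ (2 * m + 1) / fact (2 * m + 1)) (at x within ?S)"
      using scaled_power_deriv[of "2 * m + 1" x ?S] by (simp del: fact_Suc power_Suc)
    ultimately have "(h has_real_derivative
        p' ((sin x)\<^sup>2) * (2 * sin x * cos x)
        - 2 * (2 * x) ^ (2 * m + 1) / fact (2 * m + 1)) (at x within ?S)"
      unfolding h_def by (rule DERIV_diff)
    then show ?thesis by (simp add: h'_def mult_ac)
  qed
  have dh': "(h' has_real_derivative 0) (at x within ?S)" if "x \<in> ?S" for x
  proof -
    have u: "\<bar>(sin x)\<^sup>2\<bar> < 1" using that by (intro sin_squared_less_1) auto
    have "((\<lambda>t. p' ((sin t)\<^sup>2)) has_real_derivative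
        p'' ((sin x)\<^sup>2) * (2 * sin x * cos x)) (at x within ?S)"
      by (rule DERIV_chain2[where f = p' and g = "\<lambda>t. (sin t)\<^sup>2", OF dp(2)[OF u]])
         (auto intro!: derivative_eq_intros)
    moreover have "((\<lambda>t. 2 * sin t * cos t) has_real_derivative 2 * (1 - 2 * (sin x)\<^sup>2)) (at x within ?S)"
    proof -
      have "((\<lambda>t. 2 * sin t * cos t) has_real_derivative
          2 * (cos x * cos x) - 2 * (sin x * sin x)) (at x within ?S)"
        by (auto intro!: derivative_eq_intros simp: algebra_simps)
      moreover have "2 * (cos x * cos x) - 2 * (sin x * sin x) = 2 * (1 - 2 * (sin x)\<^sup>2)"
        unfolding power2_eq_square[symmetric] cos_squared_eq by (simp only: algebra_simps)
      ultimately show ?thesis by simp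
    qed
    ultimately have 1: "((\<lambda>t. 2 * sin t * cos t * p' ((sin t)\<^sup>2)) has_real_derivative 
       2 * sin x * cos x * (p'' ((sin x)\<^sup>2) * (2 * sin x * cos x))
        + 2 * (1 - 2 * (sin x)\<^sup>2) * p' ((sin x)\<^sup>2)) (at x within ?S)"
      by (rule DERIV_mult'[rotated])
    have 2: "((\<lambda>t. 2 * (2 * t) ^ (2 * m + 1) / fact (2 * m + 1)) has_real_derivative
        4 * ((2 * x) ^ (2 * m) / fact (2 * m))) (at x within ?S)"
      using DERIV_cmult[OF scaled_power_deriv[of "2 * m" x ?S], of 2]
      by (simp del: fact_Suc power_Suc)
    have "2 * sin x * cos x * (p'' ((sin x)\<^sup>2) * (2 * sin x * cos x))
        + 2 * (1 - 2 * (sin x)\<^sup>2) * p' ((sin x)\<^sup>2)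
       = 2 * (1 - 2 * (sin x)\<^sup>2) * p' ((sin x)\<^sup>2) + 4 * (sin x)\<^sup>2 * (cos x)\<^sup>2 * p'' ((sin x)\<^sup>2)"
      by (simp add: power2_eq_square)
    \<comment> \<open>The chain rule has produced exactly the left-hand side of
      \<open>arcsin_series_ode\<close> at \<open>u = (sin x)\<^sup>2\<close>, with
      \<open>(cos x)\<^sup>2\<close> in place of \<open>1 - u\<close>.\<close>
    also have "\<dots> = 4 * arcsin_series m ((sin x)\<^sup>2)"
      using arcsin_series_ode[OF u, of m] by (simp add: p'_def p''_def cos_squared_eq)
    also have "\<dots> = 4 * ((2 * x) ^ (2 * m) / fact (2 * m))"
      using Suc.IH[of x] that by auto
    finally show ?thesis
      using DERIV_diff[OF 1 2] unfolding h'_def by simp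
  qed
  have 0: "0 \<in> ?S" and t: "t \<in> ?S" using Suc.prems by auto
  \<comment> \<open>The constant coefficient is a quotient by 0 and hence 0; the other terms contain
    a power of 0.\<close>
  have "(\<lambda>n. arcsin_coeff (Suc m) n * 0 ^ n) = (\<lambda>n. 0)"
    by (intro ext, rename_tac n, case_tac n) auto
  then have "p 0 = 0" by (simp add: p_def arcsin_series_def)
  then have h0: "h 0 = 0" by (simp add: h_def)
  have "\<exists>c. \<forall>x\<in>?S. h' x = c"
    by (intro has_field_derivative_zero_constant dh') auto
  moreover have "h' 0 = 0" by (simp add: h'_def)
  ultimately have "h' x = 0" if "x \<in> ?S" for x using 0 that by metis
  then have "\<exists>c. \<forall>x\<in>?S. h x = c"
    using dh by (intro has_field_derivative_zero_constant) auto
  then have "h t = 0" using 0 t h0 by metis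
  then show ?case by (simp add: h_def p_def)
qed

lemma arcsin_power_sums:
  assumes "\<bar>t\<bar> < pi / 2"
  shows "(\<lambda>n. arcsin_coeff m n * sin t ^ (2 * n)) sums ((2 * t) ^ (2 * m) / fact (2 * m))"
  using summable_sums[OF summable_arcsin_coeff[OF sin_squared_less_1[OF assms], of m]]
  unfolding arcsin_series_sin[OF assms, symmetric] by (simp add: arcsin_series_def power_mult)

subsection \<open>Multiple zeta values as single series\<close>

text \<open>The set \<open>J\<close> of admissible last entries is a parameter so that bounded
  intervals (finite nested sums) and all positive integers (the full series) are treated
  together.\<close>

definition increasing_lists :: "nat \<Rightarrow> nat set \<Rightarrow> nat list set" where
  "increasing_lists r J =
    {ns. length ns = Suc r \<and> sorted_wrt (<) ns \<and> (\<forall>n\<in>set ns. 0 < n) \<and> last ns \<in> J}"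

definition increasing_lists_below :: "nat \<Rightarrow> nat \<Rightarrow> nat list set" where
  "increasing_lists_below r n =
    {ns. length ns = r \<and> sorted_wrt (<) ns \<and> (\<forall>x\<in>set ns. 0 < x \<and> x < n)}"

lemma finite_increasing_lists_below: "finite (increasing_lists_below r n)"
  by (rule finite_subset[OF _ finite_lists_length_eq[of "{..<n}" r]])
     (auto simp: increasing_lists_below_def)

text \<open>Splits off the largest entry. It drives both the recursion for the finite sums and the
  reduction of \<open>mzv\<close> to a single series.\<close>

lemma bij_betw_snoc_increasing:
  assumes "0 \<notin> J"
  shows "bij_betw (\<lambda>(j, ns). ns @ [j]) (SIGMA j:J. increasing_lists_below r j) (increasing_lists r J)"
proof (rule bij_betw_byWitness[where f' = "\<lambda>ns. (last ns, butlast ns)"])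
  show "(\<lambda>(j, ns). ns @ [j]) ` (SIGMA j:J. increasing_lists_below r j) \<subseteq> increasing_lists r J"
    using assms by (fastforce simp: increasing_lists_below_def increasing_lists_def sorted_wrt_append
        intro: gr0I)
  show "(\<lambda>ns. (last ns, butlast ns)) ` increasing_lists r J \<subseteq> (SIGMA j:J. increasing_lists_below r j)"
  proof (rule image_subsetI)
    fix ns assume ns: "ns \<in> increasing_lists r J"
    then have "ns \<noteq> []" by (auto simp: increasing_lists_def)
    then obtain ms j where "ns = ms @ [j]" by (metis append_butlast_last_id)
    with ns show "(last ns, butlast ns) \<in> (SIGMA j:J. increasing_lists_below r j)"
      by (auto simp: increasing_lists_def increasing_lists_below_def sorted_wrt_append)
  qed
qed (auto simp: increasing_lists_def intro!: append_butlast_last_id)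

text \<open>In an increasing list the upper bound need only be checked at the last entry; this makes
  the bijection applicable to \<open>increasing_lists_below\<close>.\<close>

lemma increasing_lists_below_Suc:
  "increasing_lists_below (Suc r) n = increasing_lists r {0<..<n}"
proof -
  have "(\<forall>x\<in>set ns. 0 < x \<and> x < n) \<longleftrightarrow> (\<forall>x\<in>set ns. 0 < x) \<and> last ns \<in> {0<..<n}"
    if "length ns = Suc r" "sorted_wrt (<) ns" for ns
  proof -
    from that have "ns \<noteq> []" by auto
    then obtain ms j where "ns = ms @ [j]" by (metis append_butlast_last_id)
    with that show ?thesis by (fastforce simp: sorted_wrt_append)
  qed
  then show ?thesis unfolding increasing_lists_below_def increasing_lists_def by blast
qed

lemma sum_increasing_lists_below:
  "(\<Sum>ns\<in>increasing_lists_below r n. \<Prod>i<r. 1 / real (ns ! i) ^ 2) = nested_sum r n"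
proof (induction r arbitrary: n)
  case 0
  have "increasing_lists_below 0 n = {[]}" by (auto simp: increasing_lists_below_def)
  then show ?case by simp
next
  case (Suc r)
  let ?f = "\<lambda>ns. \<Prod>i<Suc r. 1 / real (ns ! i) ^ 2"
  have "sum ?f (increasing_lists_below (Suc r) n)
      = (\<Sum>(j, ns)\<in>(SIGMA j:{0<..<n}. increasing_lists_below r j). ?f (ns @ [j]))"
    unfolding increasing_lists_below_Suc
    using sum.reindex_bij_betw[OF bij_betw_snoc_increasing[of "{0<..<n}" r], of ?f]
    by (simp add: case_prod_unfold)
  also have "\<dots> = (\<Sum>j\<in>{0<..<n}. \<Sum>ns\<in>increasing_lists_below r j. ?f (ns @ [j]))"
    by (intro sum.Sigma[symmetric]) (auto simp: finite_increasing_lists_below)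
  also have "\<dots> = (\<Sum>j\<in>{0<..<n}. \<Sum>ns\<in>increasing_lists_below r j. (\<Prod>i<r. 1 / real (ns ! i) ^ 2) / real j ^ 2)"
    by (intro sum.cong refl) (auto simp: increasing_lists_below_def nth_append)
  also have "\<dots> = (\<Sum>j\<in>{0<..<n}. nested_sum r j / real j ^ 2)"
    by (simp only: sum_divide_distrib[symmetric] Suc.IH)
  \<comment> \<open>\<open>nested_sum\<close> also runs over \<open>j = 0\<close>, where the term is
    a quotient by 0.\<close>
  also have "\<dots> = nested_sum (Suc r) n"
    unfolding nested_sum.simps by (intro sum.mono_neutral_left) auto
  finally show ?case .
qed

text \<open>Index lists are grouped by their largest entry. Each group is finite and contributes one
  term of the series; nonnegativity justifies the regrouping.\<close>

lemma mzv_eq_suminf: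
  assumes "k \<ge> 2"
  shows "mzv (replicate r 2 @ [k]) = (\<Sum>n. nested_sum r n / real n ^ k)"
proof -
  let ?ks = "replicate r 2 @ [k]"
  let ?f = "\<lambda>ns. \<Prod>i<length ?ks. 1 / real (ns ! i) ^ (?ks ! i)"
  let ?S = "SIGMA j:{0<..}. increasing_lists_below r j"
  define s where "s = (\<Sum>n. nested_sum r n / real n ^ k)"
  have "(\<lambda>n. nested_sum r n / real n ^ k) sums s"
    unfolding s_def using summable_nested_sum_over_power[OF assms] by (rule summable_sums)
  then have "((\<lambda>n. nested_sum r n / real n ^ k) has_sum s) UNIV"
    by (rule sums_nonneg_imp_has_sum) (simp add: nested_sum_nonneg)
  \<comment> \<open>Dropping index 0 is harmless: its denominator \<open>0 ^ k\<close> is 0 because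
    \<open>k\<close> is positive.\<close>
  then have outer: "((\<lambda>n. nested_sum r n / real n ^ k) has_sum s) {0<..}"
    by (rule has_sum_cong_neutral[THEN iffD1, rotated -1]) (use assms in auto)
  have inner: "((\<lambda>ns. ?f (ns @ [j])) has_sum nested_sum r j / real j ^ k) (increasing_lists_below r j)" for j
  proof (rule has_sum_finiteI[OF finite_increasing_lists_below])
    show "nested_sum r j / real j ^ k = (\<Sum>ns\<in>increasing_lists_below r j. ?f (ns @ [j]))"
      unfolding sum_increasing_lists_below[symmetric] sum_divide_distrib
      by (intro sum.cong refl) (auto simp: increasing_lists_below_def nth_append)
  qed
  have nn: "?f ns \<ge> 0" for ns
    by (intro prod_nonneg) auto
  have "((\<lambda>(j, ns). ?f (ns @ [j])) has_sum s) ?S"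
  proof (rule has_sum_SigmaI[OF _ outer])
    show "(\<lambda>(j, ns). ?f (ns @ [j])) summable_on ?S"
      by (rule summable_on_SigmaI[OF _ has_sum_imp_summable[OF outer]])
         (simp_all only: case_prod_conv inner nn)
  qed (use inner in auto)
  then have "(?f has_sum s) (increasing_lists r {0<..})"
    using has_sum_reindex_bij_betw[OF bij_betw_snoc_increasing[of "{0<..}" r], of ?f s]
    by (simp add: case_prod_unfold)
  also have "increasing_lists r {0<..} =
      {ns. length ns = length ?ks \<and> sorted_wrt (<) ns \<and> (\<forall>n\<in>set ns. 0 < n)}"
  proof -
    have "last ns \<in> set ns" if "length ns = Suc r" for ns :: "nat list"
      using that by (intro last_in_set) auto
    then show ?thesis unfolding increasing_lists_def by auto
  qed
  finally show ?thesis unfolding mzv_def s_def[symmetric] by (rule infsumI)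
qed

subsection \<open>The two integrals\<close>

text \<open>The power of \<open>x\<close> is integrated twice: termwise through its arcsine
  expansion, and directly by an antiderivative.\<close>

lemma mzv_twos: "mzv (replicate (Suc r) 2) = pi ^ (2 * r + 2) / fact (2 * r + 3)"
proof -
  \<comment> \<open>The expansion is only available for arguments below pi/2 in absolute value,
    hence the open interval; the endpoints do not affect the integral.\<close>
  let ?S = "{0<..<pi/2}"
  let ?f = "\<lambda>x. (2 * x) ^ (2 * Suc r) / fact (2 * Suc r)"
  let ?I = "\<lambda>n. pi / 2 * (nested_sum r n / real n ^ 2)"
  have "(?f has_integral suminf ?I) ?S"
  proof (rule has_integral_nonneg_series)
    fix n :: nat
    \<comment> \<open>The Wallis integral cancels the \<open>wallis_ratio\<close> in the
      coefficient.\<close>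
    have eq: "arcsin_coeff (Suc r) n * (pi / 2 * wallis_ratio n) = ?I n"
      using wallis_ratio_pos[of n] by (simp add: mult.commute)
    show "((\<lambda>x. arcsin_coeff (Suc r) n * sin x ^ (2 * n)) has_integral ?I n) ?S"
      unfolding eq[symmetric] has_integral_Icc_iff_Ioo[symmetric]
      by (intro has_integral_mult_right has_integral_sin_power_even)
    show "0 \<le> arcsin_coeff (Suc r) n * sin x ^ (2 * n)" for x
      by (intro mult_nonneg_nonneg arcsin_coeff_nonneg) (simp add: power_mult)
  next
    show "(\<lambda>n. arcsin_coeff (Suc r) n * sin x ^ (2 * n)) sums ?f x" if "x \<in> ?S" for x
      using that by (intro arcsin_power_sums) auto
    show "summable ?I"
      by (intro summable_mult summable_nested_sum_over_power) simp
  qed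
  also have "suminf ?I = pi / 2 * mzv (replicate (Suc r) 2)"
  proof -
    have "replicate (Suc r) 2 = replicate r 2 @ [2::nat]"
      by (simp add: replicate_append_same)
    then show ?thesis
      by (simp only: suminf_mult[OF summable_nested_sum_over_power] mzv_eq_suminf order_refl)
  qed
  finally have 1: "(?f has_integral pi / 2 * mzv (replicate (Suc r) 2)) {0..pi/2}"
    by (simp add: has_integral_Icc_iff_Ioo)
  let ?F = "\<lambda>x::real. (2 * x) ^ Suc (2 * Suc r) / fact (Suc (2 * Suc r)) / 2"
  have "(?f has_integral ?F (pi/2) - ?F 0) {0..pi/2}"
  proof (rule fundamental_theorem_of_calculus)
    show "(?F has_vector_derivative ?f x) (at x within {0..pi/2})" for x
      using DERIV_cdivide[OF scaled_power_deriv[of "2 * Suc r" x "{0..pi/2}"], of 2]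
      unfolding has_real_derivative_iff_has_vector_derivative[symmetric]
      by (simp del: fact_Suc power_Suc mult_Suc_right)
  qed simp
  from has_integral_unique[OF 1 this] have "pi / 2 * mzv (replicate (Suc r) 2) =
      pi ^ (2 * r + 3) / fact (2 * r + 3) / 2"
    by (simp del: fact_Suc replicate_Suc add: eval_nat_numeral)
  also have "\<dots> = pi / 2 * (pi ^ (2 * r + 2) / fact (2 * r + 3))"
    by (simp del: fact_Suc add: eval_nat_numeral)
  finally have eq: "pi / 2 * mzv (replicate (Suc r) 2) = pi / 2 * (pi ^ (2 * r + 2) / fact (2 * r + 3))" .
  have "a = b" if "pi / 2 * a = pi / 2 * b" for a b
    using that by simp
  from this[OF eq] show ?thesis .
qed

text \<open>The same termwise integration with the weight, which is positive on the open interval;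
  each term gains \<open>1 / (2 * n)\<close>.\<close>

lemma has_integral_weight_mzv:
  "((\<lambda>x. (pi/2 - x) * cot x * ((2 * x) ^ (2 * r + 2) / fact (2 * r + 2)))
     has_integral pi / 4 * mzv (replicate r 2 @ [3])) {0<..<pi/2}"
proof -
  let ?S = "{0<..<pi/2}"
  let ?I = "\<lambda>n. pi / 4 * (nested_sum r n / real n ^ 3)"
  let ?g = "\<lambda>n x. arcsin_coeff (Suc r) n * ((pi/2 - x) * cot x * sin x ^ (2 * n))"
  have "((\<lambda>x. (pi/2 - x) * cot x * ((2 * x) ^ (2 * r + 2) / fact (2 * r + 2)))
      has_integral suminf ?I) ?S"
  proof (rule has_integral_nonneg_series)
    fix n :: nat
    show "(?g n has_integral ?I n) ?S"
    \<comment> \<open>At index 0 the coefficient is 0, while the weighted integral formula needs a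
      positive index.\<close>
    proof (cases "n = 0")
      case False
      have eq: "arcsin_coeff (Suc r) n * (pi / (4 * real n) * wallis_ratio n) = ?I n"
        using wallis_ratio_pos[of n] by (simp add: power2_eq_square power3_eq_cube mult_ac)
      show ?thesis
        unfolding eq[symmetric] has_integral_Icc_iff_Ioo[symmetric]
        using False by (intro has_integral_mult_right has_integral_weight_sin_power) auto
    qed simp
    show "0 \<le> ?g n x" if "x \<in> ?S" for x
    proof -
      have "0 < cot x" using that by (intro cot_gt_zero) auto
      then show ?thesis using that
        by (intro mult_nonneg_nonneg arcsin_coeff_nonneg) (auto simp: power_mult)
    qed
  next
    show "(\<lambda>n. ?g n x) sums ((pi/2 - x) * cot x * ((2 * x) ^ (2 * r + 2) / fact (2 * r + 2)))"
      if "x \<in> ?S" for x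
    proof -
      have "(\<lambda>n. arcsin_coeff (Suc r) n * sin x ^ (2 * n)) sums ((2 * x) ^ (2 * Suc r) / fact (2 * Suc r))"
        using that by (intro arcsin_power_sums) auto
      from sums_mult[OF this, of "(pi/2 - x) * cot x"] show ?thesis
        by (simp add: mult_ac del: fact_Suc power_Suc)
    qed
    show "summable ?I"
      by (intro summable_mult summable_nested_sum_over_power) simp
  qed
  also have "suminf ?I = pi / 4 * mzv (replicate r 2 @ [3])"
    by (subst suminf_mult) (auto simp: summable_nested_sum_over_power mzv_eq_suminf)
  finally show ?thesis .
qed

subsection \<open>The cotangent series\<close>

lemma zeta_even_sums:
  assumes "n > 0"
  shows "(\<lambda>k. 1 / real (Suc k) ^ (2 * n)) sums zeta_even n"
proof -
  have "summable (\<lambda>k. 1 / real k ^ (2 * n))"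
    using inverse_power_summable[of "2 * n", where ?'a = real] assms by (simp add: inverse_eq_divide)
  then have "summable (\<lambda>k. 1 / real (Suc k) ^ (2 * n))"
    by (subst summable_Suc_iff)
  then show ?thesis using assms by (simp add: zeta_even_def summable_sums)
qed

lemma zeta_even_nonneg: "n > 0 \<Longrightarrow> zeta_even n \<ge> 0"
  by (rule sums_le[OF _ sums_zero zeta_even_sums]) auto

text \<open>The logarithm of Euler's sine product, with each -ln(1 - x^2/k^2) expanded in powers of
  x^2. Summing over \<open>k\<close> first gives the zeta values.\<close>

lemma ln_sin_sums:
  fixes x :: real
  assumes x: "0 < x" "x < 1"
  shows "(\<lambda>n. zeta_even n / real n * (x\<^sup>2) ^ n) sums (ln (pi * x) - ln (sin (pi * x)))"
proof -
  define L where "L = ln (pi * x) - ln (sin (pi * x))"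
  have sin_pos: "sin (pi * x) > 0" using x by (intro sin_gt_zero) auto
  let ?y = "\<lambda>k. x\<^sup>2 / real (Suc k) ^ 2"
  have y: "0 \<le> ?y k" "?y k < 1" for k
  proof -
    have "x\<^sup>2 < 1" using x by (simp add: power_less_one_iff)
    also have "1 \<le> real (Suc k) ^ 2" by (intro one_le_power) simp
    finally show "?y k < 1" by simp
  qed simp
  have "(\<lambda>n. ln (\<Prod>k=1..n. 1 - x\<^sup>2 / real k ^ 2)) \<longlonglongrightarrow> ln (sin (pi * x) / (pi * x))"
    using x sin_pos by (intro tendsto_ln sin_product_formula_real') auto
  also have "(\<lambda>n. ln (\<Prod>k=1..n. 1 - x\<^sup>2 / real k ^ 2)) = (\<lambda>n. \<Sum>k<n. ln (1 - ?y k))"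
  proof
    fix n
    have "(\<Prod>k=1..n. 1 - x\<^sup>2 / real k ^ 2) = (\<Prod>k<n. 1 - ?y k)"
      by (rule prod.reindex_bij_witness[of _ Suc "\<lambda>k. k - 1"]) auto
    then show "ln (\<Prod>k=1..n. 1 - x\<^sup>2 / real k ^ 2) = (\<Sum>k<n. ln (1 - ?y k))"
      using y(2) ln_prod[of "{..<n}" "\<lambda>k. 1 - ?y k"]
      by (simp only: finite_lessThan) (metis diff_gt_0_iff_gt less_irrefl)
  qed
  finally have "(\<lambda>k. ln (1 - ?y k)) sums ln (sin (pi * x) / (pi * x))"
    by (simp add: sums_def)
  then have "(\<lambda>k. - ln (1 - ?y k)) sums L"
    using sums_minus x sin_pos by (fastforce simp: ln_div L_def)
  then have outer: "((\<lambda>k. - ln (1 - ?y k)) has_sum L) UNIV"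
    using y by (intro sums_nonneg_imp_has_sum) auto
  let ?f = "\<lambda>(k, n). ?y k ^ n / real n"
  have inner: "((\<lambda>n. ?f (k, n)) has_sum - ln (1 - ?y k)) UNIV" for k
    using sums_minus[OF ln_series'[of "- ?y k"]] y[of k]
    by (intro sums_nonneg_imp_has_sum) (auto simp: abs_less_iff)
  have "(?f has_sum L) (UNIV \<times> UNIV)"
  proof (rule has_sum_SigmaI[OF _ outer])
    show "?f summable_on UNIV \<times> UNIV"
      by (rule summable_on_SigmaI[OF inner has_sum_imp_summable[OF outer]]) (use y in auto)
  qed (rule inner)
  \<comment> \<open>All terms of the double series are nonnegative and it is summable, so the order
    of summation may be exchanged.\<close>
  then have swapped: "((\<lambda>(n, k). ?y k ^ n / real n) has_sum L) (UNIV \<times> UNIV)"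
    by (subst (asm) has_sum_swap) simp
  have "((\<lambda>k. ?y k ^ n / real n) has_sum zeta_even n / real n * (x\<^sup>2) ^ n) UNIV" for n
  proof (cases "n = 0")
    case False
    have "(\<lambda>k. (x\<^sup>2) ^ n / real n * (1 / real (Suc k) ^ (2 * n))) sums ((x\<^sup>2) ^ n / real n * zeta_even n)"
      using False by (intro sums_mult zeta_even_sums) auto
    moreover have "(x\<^sup>2) ^ n / real n * (1 / real (Suc k) ^ (2 * n)) = ?y k ^ n / real n" for k
      by (simp add: power_divide power_mult del: of_nat_Suc)
    ultimately have "(\<lambda>k. ?y k ^ n / real n) sums (zeta_even n / real n * (x\<^sup>2) ^ n)"
      by (simp add: mult.commute)
    then show ?thesis
      using y by (intro sums_nonneg_imp_has_sum) auto
  qed simp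
  then have "((\<lambda>n. zeta_even n / real n * (x\<^sup>2) ^ n) has_sum L) UNIV"
    using has_sum_SigmaD[OF swapped] by simp
  then show ?thesis unfolding L_def by (rule has_sum_imp_sums)
qed

text \<open>Differentiating \<open>ln_sin_sums\<close> at \<open>x / pi\<close> gives
  \<open>1 / x - cot x\<close>; multiplication by \<open>x / 2\<close> restores the powers.\<close>

lemma cot_sums:
  assumes x: "0 < x" "x < pi"
  shows "(\<lambda>n. zeta_even n * (x / pi) ^ (2 * n)) sums (- (x * cot x) / 2)"
proof -
  define b where "b = (\<lambda>n. zeta_even n / real n)"
  define P where "P = (\<lambda>u. \<Sum>n. b n * u ^ n)"
  define D where "D = (\<Sum>n. diffs b n * ((x / pi)\<^sup>2) ^ n)"
  \<comment> \<open>As \<open>b\<close> is nonnegative, absolute convergence follows from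
    \<open>ln_sin_sums\<close> at \<open>sqrt \<bar>u\<bar>\<close>; that lemma needs a positive
    argument, so \<open>u = 0\<close> is separate.\<close>
  have sm: "summable (\<lambda>n. b n * u ^ n)" if "\<bar>u\<bar> < 1" for u
  proof (rule summable_rabs_cancel, cases "u = 0")
    case False
    have "summable (\<lambda>n. b n * ((sqrt \<bar>u\<bar>)\<^sup>2) ^ n)"
      using ln_sin_sums[of "sqrt \<bar>u\<bar>"] that False unfolding b_def by (auto dest: sums_summable)
    moreover have "\<bar>b n\<bar> = b n" for n
      using zeta_even_nonneg[of n] by (cases "n = 0") (auto simp: b_def)
    ultimately show "summable (\<lambda>n. \<bar>b n * u ^ n\<bar>)" by (simp add: abs_mult power_abs)
  next
    case True
    then show "summable (\<lambda>n. \<bar>b n * u ^ n\<bar>)"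
      by (intro summable_finite[of "{0}"]) auto
  qed
  have u: "\<bar>(x / pi)\<^sup>2\<bar> < 1"
    using x by (simp add: power_less_one_iff)
  have "(P has_real_derivative D) (at ((x / pi)\<^sup>2))"
    unfolding P_def D_def using sm u by (intro termdiffs_strong'[of 1]) auto
  then have "((\<lambda>t. P ((t / pi)\<^sup>2)) has_real_derivative D * (2 * x / pi\<^sup>2)) (at x)"
    by (rule DERIV_chain2[where f = P and g = "\<lambda>t. (t / pi)\<^sup>2"])
       (auto intro!: derivative_eq_intros simp: power2_eq_square)
  moreover have "((\<lambda>t. P ((t / pi)\<^sup>2)) has_real_derivative 1 / x - cot x) (at x)"
  proof (rule has_field_derivative_transform_within_open)
    have "sin x > 0" using x by (intro sin_gt_zero)
    then show "((\<lambda>t. ln t - ln (sin t)) has_real_derivative 1 / x - cot x) (at x)"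
      using x by (auto intro!: derivative_eq_intros simp: cot_def)
    show "ln t - ln (sin t) = P ((t / pi)\<^sup>2)" if "t \<in> {0<..<pi}" for t
      using sums_unique[OF ln_sin_sums[of "t / pi"]] that by (simp add: P_def b_def)
  qed (use x in auto)
  ultimately have deriv: "D * (2 * x / pi\<^sup>2) = 1 / x - cot x"
    by (rule DERIV_unique)
  have "summable (\<lambda>n. diffs b n * ((x / pi)\<^sup>2) ^ n)"
    using sm u by (intro termdiff_converges[of _ 1]) auto
  then have "(\<lambda>n. real n * b n * ((x / pi)\<^sup>2) ^ n) sums ((x / pi)\<^sup>2 * D)"
    unfolding D_def by (rule sums_index_mult)
  moreover have "(x / pi)\<^sup>2 * D = x / 2 * (D * (2 * x / pi\<^sup>2))"
    by (simp add: power2_eq_square)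
  ultimately have "(\<lambda>n. real n * b n * ((x / pi)\<^sup>2) ^ n) sums (1 / 2 - x * cot x / 2)"
    unfolding deriv using x by (simp add: right_diff_distrib)
  \<comment> \<open>The constant 1/2 is moved into the series as its term of index 0, which is where
    zeta(0) = -1/2 enters.\<close>
  from sums_add[OF this sums_single[of 0 "\<lambda>_. - (1 / 2)"]]
  have "(\<lambda>n. real n * b n * ((x / pi)\<^sup>2) ^ n + (if n = 0 then - (1 / 2) else 0)) sums (- (x * cot x) / 2)"
    by simp
  also have "(\<lambda>n. real n * b n * ((x / pi)\<^sup>2) ^ n + (if n = 0 then - (1 / 2) else 0))
      = (\<lambda>n. zeta_even n * (x / pi) ^ (2 * n))"
    by (auto simp: b_def zeta_even_def power_mult)
  finally show ?thesis .
qed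

section \<open>The weighted integral in terms of zeta values\<close>

text \<open>With \<open>k = 2 * n + 2 * r\<close> the denominator supplies the two consecutive
  factors in the series of the theorem.\<close>

lemma has_integral_linear_times_power:
  "((\<lambda>x. (pi/2 - x) * x ^ Suc k) has_integral
      (pi/2) ^ (k + 3) / ((real k + 2) * (real k + 3))) {0<..<pi/2}"
proof -
  let ?F = "\<lambda>x. pi/2 * x ^ (k + 2) / (real k + 2) - x ^ (k + 3) / (real k + 3)"
  have "((\<lambda>x. (pi/2 - x) * x ^ Suc k) has_integral ?F (pi/2) - ?F 0) {0..pi/2}"
  proof (rule fundamental_theorem_of_calculus)
    fix x :: real
    have 1: "((\<lambda>x. x ^ (k + 2)) has_real_derivative (real k + 2) * x ^ Suc k) (at x within {0..pi/2})"
      by (rule derivative_eq_intros refl | simp)+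
    have 2: "((\<lambda>x. x ^ (k + 3)) has_real_derivative (real k + 3) * x ^ (k + 2)) (at x within {0..pi/2})"
      by (rule derivative_eq_intros refl | simp)+
    have "(?F has_real_derivative pi/2 * ((real k + 2) * x ^ Suc k) / (real k + 2)
        - (real k + 3) * x ^ (k + 2) / (real k + 3)) (at x within {0..pi/2})"
      by (intro DERIV_diff DERIV_cdivide DERIV_cmult 1 2)
    moreover have "pi/2 * ((real k + 2) * x ^ Suc k) / (real k + 2)
        - (real k + 3) * x ^ (k + 2) / (real k + 3) = (pi/2 - x) * x ^ Suc k"
    proof -
      have "pi/2 * (N * z) / N - M * (x * z) / M = (pi/2 - x) * z" if "N > 0" "M > 0" for N M z :: real
        using that by (simp add: left_diff_distrib)
      from this[of "real k + 2" "real k + 3" "x ^ Suc k"] show ?thesis by simp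
    qed
    ultimately show "(?F has_vector_derivative (pi/2 - x) * x ^ Suc k) (at x within {0..pi/2})"
      by (simp add: has_real_derivative_iff_has_vector_derivative)
  qed simp
  also have "?F (pi/2) - ?F 0 = (pi/2) ^ (k + 3) * (1 / (real k + 2) - 1 / (real k + 3))"
    by (simp add: right_diff_distrib eval_nat_numeral)
  also have "1 / (real k + 2) - 1 / (real k + 3) = 1 / ((real k + 2) * (real k + 3))"
    by (simp add: field_simps)
  finally show ?thesis by (simp add: has_integral_Icc_iff_Ioo)
qed

text \<open>One factor \<open>x\<close> is joined to \<open>cot x\<close> and expanded by
  \<open>cot_sums\<close>. The integrand is negated so that all terms of positive index are
  nonnegative.\<close>

lemma zeta_even_series_integral:
  fixes r :: nat
  defines "T \<equiv> \<lambda>n. zeta_even n / ((2 * real n + 2 * real r + 2) * (2 * real n + 2 * real r + 3) * 2 ^ (2 * n))"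
  shows "((\<lambda>x. - ((pi/2 - x) * cot x * ((2 * x) ^ (2 * r + 2) / fact (2 * r + 2)))) has_integral
      pi ^ (2 * r + 3) / fact (2 * r + 2) * suminf T) {0<..<pi/2}"
proof -
  let ?F = "fact (2 * r + 2) :: real"
  \<comment> \<open>The exponent exceeds \<open>2 * r + 2\<close> by one to offset the division by 2
    in \<open>cot_sums\<close>; multiplying \<open>?C\<close> by \<open>(pi/2) ^ (2 * r + 3)\<close>
    gives \<open>?D\<close>.\<close>
  let ?C = "2 ^ (2 * r + 3) / ?F"
  let ?D = "pi ^ (2 * r + 3) / ?F"
  let ?g = "\<lambda>n x. zeta_even n / pi ^ (2 * n) * ?C * ((pi/2 - x) * x ^ Suc (2 * n + 2 * r))"
  have smT: "summable T"
  proof -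
    \<comment> \<open>The cotangent series at pi/2 dominates \<open>T\<close> from index 1 on; index
      0 is excluded since \<open>zeta_even 0\<close> is negative.\<close>
    have "(\<lambda>n. zeta_even n * (pi / 2 / pi) ^ (2 * n)) sums (- (pi / 2 * cot (pi / 2)) / 2)"
      using pi_gt_zero by (intro cot_sums) auto
    then have "(\<lambda>n. zeta_even n * (1 / 2) ^ (2 * n)) sums (- (pi / 2 * cot (pi / 2)) / 2)"
      by simp
    then have s: "summable (\<lambda>n. zeta_even n * (1 / 2) ^ (2 * n))"
      by (rule sums_summable)
    show ?thesis
    proof (rule summable_comparison_test'[OF s, of 1])
      fix n :: nat assume n: "n \<ge> 1"
      let ?d = "(2 * real n + 2 * real r + 2) * (2 * real n + 2 * real r + 3)"
      have "1 * 1 \<le> ?d" by (intro mult_mono) auto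
      then have d: "1 \<le> ?d" by simp
      have z: "0 \<le> zeta_even n * (1 / 2) ^ (2 * n)" using n zeta_even_nonneg[of n] by simp
      have "T n = zeta_even n * (1 / 2) ^ (2 * n) / ?d"
        by (simp add: T_def power_one_over)
      moreover have "zeta_even n * (1 / 2) ^ (2 * n) / ?d \<le> zeta_even n * (1 / 2) ^ (2 * n) / 1"
        using d z by (intro divide_left_mono) auto
      moreover have "0 \<le> zeta_even n * (1 / 2) ^ (2 * n) / ?d"
        using d z by (intro divide_nonneg_nonneg) auto
      ultimately show "norm (T n) \<le> zeta_even n * (1 / 2) ^ (2 * n)"
        by simp
    qed
  qed
  have "((\<lambda>x. - ((pi/2 - x) * cot x * ((2 * x) ^ (2 * r + 2) / ?F))) has_integral
      (\<Sum>n. ?D * T n)) {0<..<pi/2}"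
  proof (rule has_integral_nonneg_series)
    fix n :: nat
    have "?D * T n = zeta_even n / pi ^ (2 * n) * ?C *
        ((pi/2) ^ (2 * n + 2 * r + 3) / ((real (2 * n + 2 * r) + 2) * (real (2 * n + 2 * r) + 3)))"
    proof -
      have *: "p3 / f * (z / (d * q)) = z / p * (t3 / f) * ((p * p3) / (q * t3) / d)"
        if "p > 0" "t3 > 0" for p3 f z d q p t3 :: real
        using that by (simp add: mult_ac)
      have pw: "(pi/2) ^ (2 * n + 2 * r + 3) =
          (pi ^ (2 * n) * pi ^ (2 * r + 3)) / (2 ^ (2 * n) * 2 ^ (2 * r + 3))"
        by (simp only: power_divide power_add[symmetric] add.assoc)
      have d: "(2 * real n + 2 * real r + 2) * (2 * real n + 2 * real r + 3) =
          (real (2 * n + 2 * r) + 2) * (real (2 * n + 2 * r) + 3)"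
        by simp
      show ?thesis
        unfolding T_def pw d by (rule *) auto
    qed
    then show "(?g n has_integral ?D * T n) {0<..<pi/2}"
      using has_integral_mult_right[OF has_integral_linear_times_power[of "2 * n + 2 * r"],
          of "zeta_even n / pi ^ (2 * n) * ?C"] by simp
    show "0 \<le> ?g n x" if "0 < n" "x \<in> {0<..<pi/2}" for x
      using that zeta_even_nonneg by (intro mult_nonneg_nonneg divide_nonneg_nonneg) auto
  next
    fix x assume x: "x \<in> {0<..<pi/2}"
    have "(\<lambda>n. ?C * ((pi/2 - x) * x ^ Suc (2 * r)) * (zeta_even n * (x / pi) ^ (2 * n))) sums
        (?C * ((pi/2 - x) * x ^ Suc (2 * r)) * (- (x * cot x) / 2))"
      using x by (intro sums_mult cot_sums) auto
    also have "(\<lambda>n. ?C * ((pi/2 - x) * x ^ Suc (2 * r)) * (zeta_even n * (x / pi) ^ (2 * n))) = (\<lambda>n. ?g n x)"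
      by (simp add: power_divide power_add mult_ac del: fact_Suc)
    also have "?C * ((pi/2 - x) * x ^ Suc (2 * r)) * (- (x * cot x) / 2) =
        - ((pi/2 - x) * cot x * ((2 * x) ^ (2 * r + 2) / ?F))"
    proof -
      have "2 ^ (2 * r + 3) * x ^ Suc (2 * r) * x = 2 * (2 * x) ^ (2 * r + 2)"
        by (simp add: power_mult_distrib eval_nat_numeral)
      then have "2 ^ (2 * r + 3) * x ^ Suc (2 * r) * x / ?F = 2 * ((2 * x) ^ (2 * r + 2) / ?F)"
        by (simp only: times_divide_eq_right)
      moreover have "c / f * (y * z) * (- (x * w) / 2) = - (y * w * G)"
        if "c * z * x / f = 2 * G" for c f y z w G :: real
      proof -
        have "c / f * (y * z) * (- (x * w) / 2) = - (y * w * (c * z * x / f / 2))"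
          by simp
        then show ?thesis using that by simp
      qed
      ultimately show ?thesis by blast
    qed
    finally show "(\<lambda>n. ?g n x) sums (- ((pi/2 - x) * cot x * ((2 * x) ^ (2 * r + 2) / ?F)))" .
  next
    show "summable (\<lambda>n. ?D * T n)" using smT by (rule summable_mult)
  qed
  then show ?thesis by (simp only: suminf_mult[OF smT])
qed

theorem theorem2p4:
  fixes r :: nat
  shows "mzv (replicate r 2 @ [3]) =
    - 4 * (2 * real r + 3)
      * (\<Sum>n. zeta_even n / ((2 * real n + 2 * real r + 2) * (2 * real n + 2 * real r + 3) * 2 ^ (2 * n)))
      * mzv (replicate (Suc r) 2)"
    (is "_ = - 4 * _ * ?\<Sigma> * _")
proof -
  \<comment> \<open>Both sides are the integral of the same negated weighted function.\<close>
  have "- (pi / 4 * mzv (replicate r 2 @ [3])) = pi ^ (2 * r + 3) / fact (2 * r + 2) * ?\<Sigma>"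
    using has_integral_neg[OF has_integral_weight_mzv] zeta_even_series_integral
    by (rule has_integral_unique)
  then have "mzv (replicate r 2 @ [3]) = - 4 * ?\<Sigma> * (pi ^ (2 * r + 3) / fact (2 * r + 2) / pi)"
    by (simp add: field_simps del: fact_Suc)
  \<comment> \<open>The factor \<open>2 * r + 3\<close> turns the factorial here into the one in
    \<open>mzv_twos\<close>.\<close>
  also have "pi ^ (2 * r + 3) / fact (2 * r + 2) / pi = (2 * real r + 3) * mzv (replicate (Suc r) 2)"
  proof -
    have "fact (2 * r + 3) = (2 * real r + 3) * fact (2 * r + 2)"
      using fact_Suc[of "2 * r + 2", where ?'a = real] by (simp add: eval_nat_numeral del: fact_Suc)
    moreover have "pi ^ (2 * r + 3) = pi * pi ^ (2 * r + 2)"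
      by (simp add: eval_nat_numeral)
    moreover have "pi * b / f / pi = z * (b / (z * f))" if "z > 0" for b f z :: real
      using that by simp
    ultimately show ?thesis
      unfolding mzv_twos by simp
  qed
  finally show ?thesis by (simp only: mult_ac)
qed

end
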